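(* Let $n\geq 3$. The adjacency algebra of the halved $n$-cube contains a complex Hadamard matrix if and only if $n$ is odd.
   Context: The halved $n$-cube is the graph whose vertex set is the set of binary words of length $n$ of even Hamming weight, two words being adjacent if and only if they differ in exactly two coordinates. The adjacency algebra of a graph is the complex algebra spanned by the powers of its adjacency matrix (for a distance-regular graph of diameter $d$ this is the span of the distance-$j$ matrices, $j=0,\ldots,d$). A $v\times v$ matrix $W$ with nonzero entries is type II if $\sum_{c=1}^v W_{ac}/W_{bc}$ equals $v$ when $a=b$ and $0$ otherwise; a complex Hadamard matrix is a type II matrix all of whose entries have absolute value $1$. *)

theory Defs
  imports
    "Jordan_Normal_Form.VS_Connect"
    "Graph_Theory.Pair_Digraph"
begin

text \<open>
  Matrices are indexed by natural numbers, so the matrices attached to a graph depend on an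
  enumeration \<open>vs\<close> of its vertices, i.e. a list with \<open>distinct vs\<close> and \<open>set vs = verts G\<close>.
  Changing the enumeration conjugates them by a permutation matrix.
\<close>

definition adjacency_matrix :: "('a, 'b) pre_digraph \<Rightarrow> 'a list \<Rightarrow> complex mat" where
  "adjacency_matrix G vs =
     mat (length vs) (length vs) (\<lambda>(i, j). if vs ! i \<rightarrow>\<^bsub>G\<^esub> vs ! j then 1 else 0)"

text \<open>
  The constant \<open>module.span\<close> takes a ring and a module as its first two arguments; \<open>class_ring\<close>
  is here the field of complex numbers. The power with exponent \<open>0\<close> is the identity matrix.
\<close>

definition adjacency_algebra :: "('a, 'b) pre_digraph \<Rightarrow> 'a list \<Rightarrow> complex mat set" where
  "adjacency_algebra G vs =
     LinearCombinations.module.span class_ring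
       (module_mat TYPE(complex) (length vs) (length vs))
       (range (\<lambda>k. adjacency_matrix G vs ^\<^sub>m k))"

definition type_II :: "complex mat \<Rightarrow> bool" where
  "type_II W \<longleftrightarrow> square_mat W \<and>
     (\<forall>a < dim_row W. \<forall>b < dim_row W. W $$ (a, b) \<noteq> 0) \<and>
     (\<forall>a < dim_row W. \<forall>b < dim_row W.
        (\<Sum>c < dim_row W. W $$ (a, c) / W $$ (b, c)) = (if a = b then of_nat (dim_row W) else 0))"

definition complex_hadamard :: "complex mat \<Rightarrow> bool" where
  "complex_hadamard W \<longleftrightarrow> type_II W \<and>
     (\<forall>a < dim_row W. \<forall>b < dim_row W. cmod (W $$ (a, b)) = 1)"

definition even_words :: "nat \<Rightarrow> bool list set" where
  "even_words n = {w. length w = n \<and> even (count_list w True)}"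

definition hamming_dist :: "'a list \<Rightarrow> 'a list \<Rightarrow> nat" where
  "hamming_dist u v = card {i. i < length u \<and> u ! i \<noteq> v ! i}"

definition halved_cube :: "nat \<Rightarrow> bool list pair_pre_digraph" where
  "halved_cube n =
     \<lparr> pverts = even_words n,
       parcs = {(u, v). u \<in> even_words n \<and> v \<in> even_words n \<and> hamming_dist u v = 2} \<rparr>"

lemma finite_even_words: "finite (even_words n)"
  by (rule finite_subset[OF _ finite_lists_length_eq[of UNIV n]]) (auto simp: even_words_def)

lemma hamming_dist_commute: "length u = length v \<Longrightarrow> hamming_dist u v = hamming_dist v u"
  unfolding hamming_dist_def by (rule arg_cong[where f = card]) auto

lemma pair_graph_halved_cube: "pair_graph (halved_cube n)"
proof
  let ?G = "halved_cube n"
  show "finite (pverts ?G)"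
    by (simp add: halved_cube_def finite_even_words)
  show "finite (parcs ?G)"
    by (rule finite_subset[of _ "even_words n \<times> even_words n"])
      (auto simp: halved_cube_def finite_even_words)
  show "symmetric ?G"
    by (auto simp: symmetric_def halved_cube_def even_words_def hamming_dist_commute intro!: symI)
qed (auto simp: halved_cube_def hamming_dist_def)

lemma ex_enumeration_halved_cube: "\<exists>vs. distinct vs \<and> set vs = verts (halved_cube n)"
  using finite_distinct_list[OF finite_even_words] by (auto simp: halved_cube_def)

end

theory Submission
  imports Defs
begin

text \<open>
  Identify even words with even subsets of \<open>{..<n}\<close>, so that the distance is the size of the
  symmetric difference. Multiplying by the adjacency matrix maps the distance-\<open>2j\<close> matrix to a
  combination of distance matrices whose coefficient at distance \<open>2j + 2\<close> is nonzero and which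
  vanishes beyond; hence the adjacency algebra consists of all matrices \<open>f (dist(S, T))\<close>.

  Suppose such a matrix is complex Hadamard. Compare the rows of \<open>{}\<close> and \<open>{0, 1}\<close>. The columns
  containing exactly one of \<open>0\<close>, \<open>1\<close> are half of all columns, since \<open>n \<ge> 3\<close>, and each contributes
  the ratio \<open>1\<close>; so all the other ratios, being unimodular, must equal \<open>-1\<close>. Therefore
  \<open>f (k + 2) = - f k\<close> for all even \<open>k\<close>. If \<open>n\<close> is even, the rows of \<open>{}\<close> and \<open>{..<n}\<close> are then
  proportional, a contradiction. If \<open>n\<close> is odd, take \<open>f k = (-1) ^ (k / 2)\<close>: for \<open>U \<noteq> V\<close> choose \<open>i\<close>
  inside and \<open>j\<close> outside the symmetric difference of \<open>U\<close> and \<open>V\<close> (which has even size, so is not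
  everything); toggling \<open>i\<close> and \<open>j\<close> in the column reverses the sign of its contribution.
\<close>

section \<open>The group of even subsets under symmetric difference\<close>

definition even_subsets :: "nat \<Rightarrow> nat set set" where
  "even_subsets n = {S. S \<subseteq> {..<n} \<and> even (card S)}"

lemma even_subsetsI: "S \<subseteq> {..<n} \<Longrightarrow> even (card S) \<Longrightarrow> S \<in> even_subsets n"
  by (simp add: even_subsets_def)

lemma even_subsetsD:
  assumes "S \<in> even_subsets n"
  shows "S \<subseteq> {..<n}" "even (card S)" "finite S" "card S \<le> n"
  using assms finite_subset[of S "{..<n}"] card_mono[of "{..<n}" S]
  by (auto simp: even_subsets_def)

lemma finite_even_subsets [simp]: "finite (even_subsets n)"
  by (rule finite_subset[of _ "Pow {..<n}"]) (auto simp: even_subsets_def)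

text \<open>Both sides count the elements of \<open>S \<inter> T\<close> twice. The additive form
  avoids truncated subtraction, so that parity and size bounds follow by linear arithmetic.\<close>

lemma card_sym_diff:
  assumes "finite S" "finite T"
  shows "card (sym_diff S T) + 2 * card (S \<inter> T) = card S + card T"
proof -
  have "card (sym_diff S T) = card (S - T) + card (T - S)"
    using assms by (intro card_Un_disjoint) auto
  moreover have "card S = card (S - T) + card (S \<inter> T)"
    using assms card_Int_Diff[of S T] by simp
  moreover have "card T = card (T - S) + card (S \<inter> T)"
    using assms card_Int_Diff[of T S] by (simp add: Int_commute)
  ultimately show ?thesis by simp
qed

lemma even_card_sym_diff:
  assumes "finite S" "finite T"
  shows "even (card (sym_diff S T)) \<longleftrightarrow> even (card S + card T)"
  using card_sym_diff[OF assms] by presburger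

lemma sym_diff_even_subsets:
  assumes "S \<in> even_subsets n" "T \<in> even_subsets n"
  shows "sym_diff S T \<in> even_subsets n"
  using even_subsetsD[OF assms(1)] even_subsetsD[OF assms(2)]
  by (intro even_subsetsI) (auto simp: even_card_sym_diff)

lemma sym_diff_cancel [simp]: "sym_diff (sym_diff S T) T = S"
  by auto

lemma sym_diff_assoc: "sym_diff S (sym_diff T U) = sym_diff (sym_diff S T) U"
  by auto

text \<open>Translation by an even subset is an involution of the even subsets.\<close>

lemma sum_even_subsets_translate:
  assumes "T \<in> even_subsets n"
  shows "(\<Sum>C\<in>even_subsets n. g C) = (\<Sum>C\<in>even_subsets n. g (sym_diff C T))"
  by (rule sum.reindex_bij_witness[of _ "\<lambda>C. sym_diff C T" "\<lambda>C. sym_diff C T"])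
    (use assms sym_diff_even_subsets in \<open>simp_all only: sym_diff_cancel\<close>)

section \<open>Moving by two elements\<close>

text \<open>This is the entry of \<open>dist_mat f * adj\<close> at two vertices with symmetric
  difference \<open>D\<close>; \<open>P\<close> is the symmetric difference of the intermediate
  vertex and the column vertex.\<close>

definition step_sum :: "nat \<Rightarrow> (nat \<Rightarrow> complex) \<Rightarrow> nat set \<Rightarrow> complex" where
  "step_sum n f D =
     (\<Sum>P\<in>even_subsets n. f (card (sym_diff P D)) * (if card P = 2 then 1 else 0))"

text \<open>A permutation \<open>r\<close> of \<open>{..<n}\<close> taking \<open>D\<close> to
  \<open>D'\<close> preserves all sizes and permutes the even subsets. It is glued from a bijection
  between \<open>D\<close> and \<open>D'\<close> and one between their complements. This is what
  keeps products with the adjacency matrix functions of the distance alone.\<close>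

lemma step_sum_cong_card:
  assumes "D \<subseteq> {..<n}" "D' \<subseteq> {..<n}" "card D = card D'"
  shows "step_sum n f D = step_sum n f D'"
proof -
  have fin: "finite D" "finite D'"
    using assms finite_subset by blast+
  obtain p where p: "bij_betw p D D'"
    using assms fin finite_same_card_bij by blast
  have "card ({..<n} - D) = card ({..<n} - D')"
    using assms fin by (simp add: card_Diff_subset)
  then obtain q where q: "bij_betw q ({..<n} - D) ({..<n} - D')"
    using finite_same_card_bij[of "{..<n} - D" "{..<n} - D'"] by auto
  define r where "r x = (if x \<in> D then p x else q x)" for x
  have rD: "bij_betw r D D'"
    using p by (subst bij_betw_cong[of _ _ p]) (simp_all add: r_def)
  have rC: "bij_betw r ({..<n} - D) ({..<n} - D')"
    using q by (subst bij_betw_cong[of _ _ q]) (simp_all add: r_def)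
  have r: "bij_betw r {..<n} {..<n}"
    using bij_betw_combine[OF rD rC] assms by (simp add: Un_absorb1)
  have inj: "inj_on r {..<n}" and rim: "r ` {..<n} = {..<n}"
    using r by (auto simp: bij_betw_def)
  have rDim: "r ` D = D'"
    using rD by (simp add: bij_betw_def)
  have card_r: "card (r ` P) = card P" if "P \<subseteq> {..<n}" for P
    by (intro card_image inj_on_subset[OF inj that])
  have "bij_betw ((`) r) (even_subsets n) (even_subsets n)"
  proof (rule bij_betwI')
    fix P Q assume "P \<in> even_subsets n" "Q \<in> even_subsets n"
    then show "(r ` P = r ` Q) = (P = Q)"
      by (intro inj_on_image_eq_iff[OF inj] even_subsetsD(1))
  next
    fix P assume P: "P \<in> even_subsets n"
    have "r ` P \<subseteq> {..<n}"
      using image_mono[OF even_subsetsD(1)[OF P], of r] by (simp only: rim)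
    then show "r ` P \<in> even_subsets n"
      using card_r[OF even_subsetsD(1)[OF P]] even_subsetsD(2)[OF P]
      by (intro even_subsetsI) simp_all
  next
    fix Q assume Q: "Q \<in> even_subsets n"
    have "Q \<subseteq> r ` {..<n}"
      using even_subsetsD(1)[OF Q] by (simp only: rim)
    then obtain P where P: "P \<subseteq> {..<n}" "Q = r ` P"
      by (rule subset_imageE)
    then have "P \<in> even_subsets n"
      using card_r[OF P(1)] even_subsetsD(2)[OF Q] by (intro even_subsetsI) simp_all
    then show "\<exists>P\<in>even_subsets n. Q = r ` P"
      using P(2) by blast
  qed
  then have "step_sum n f D' = (\<Sum>P\<in>even_subsets n.
      f (card (sym_diff (r ` P) D')) * (if card (r ` P) = 2 then 1 else 0))"
    unfolding step_sum_def by (rule sum.reindex_bij_betw[symmetric])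
  also have "\<dots> = step_sum n f D"
    unfolding step_sum_def
  proof (rule sum.cong[OF refl])
    fix P assume P: "P \<in> even_subsets n"
    note PD = even_subsetsD(1)[OF P]
    have "sym_diff (r ` P) D' = r ` sym_diff P D"
      using inj_on_image_set_diff[OF inj, of P D] inj_on_image_set_diff[OF inj, of D P]
        PD assms(1) rDim by (auto simp: image_Un)
    moreover have "sym_diff P D \<subseteq> {..<n}"
      using PD assms(1) by blast
    ultimately have "card (sym_diff (r ` P) D') = card (sym_diff P D)"
      by (simp only: card_r)
    then show "f (card (sym_diff (r ` P) D')) * (if card (r ` P) = 2 then 1 else 0) =
        f (card (sym_diff P D)) * (if card P = 2 then 1 else 0)"
      by (simp only: card_r[OF PD])
  qed
  finally show ?thesis by simp
qed

text \<open>A set \<open>P\<close> of size 2 meets \<open>D\<close> in at most two elements, so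
  toggling it lowers the size of \<open>D\<close> by at most 2.\<close>

lemma step_sum_indicator_eq_0:
  assumes "finite D" "card D > k + 2"
  shows "step_sum n (\<lambda>e. if e = k then 1 else 0) D = 0"
  unfolding step_sum_def
proof (rule sum.neutral, safe)
  fix P assume P: "P \<in> even_subsets n"
  have "card (sym_diff P D) \<noteq> k" if "card P = 2"
  proof -
    have "card (P \<inter> D) \<le> card P"
      using even_subsetsD(3)[OF P] by (intro card_mono) auto
    then show ?thesis
      using card_sym_diff[OF even_subsetsD(3)[OF P] assms(1)] that assms(2) by linarith
  qed
  then show "(if card (sym_diff P D) = k then 1 else 0) * (if card P = 2 then 1 else 0) = (0 :: complex)"
    by auto
qed

text \<open>The sum counts certain sets \<open>P\<close>, and \<open>{..<2}\<close> is one of them.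
  This also covers \<open>k + 2 > n\<close>, where \<open>{..<k + 2}\<close> leaves
  \<open>{..<n}\<close>; such \<open>k\<close> occur in the induction of
  \<open>dist_mat_in_adj_span\<close>.\<close>

lemma step_sum_indicator_neq_0:
  assumes "2 \<le> n"
  shows "step_sum n (\<lambda>e. if e = k then 1 else 0) {..<k + 2} \<noteq> 0"
proof -
  let ?X = "{P \<in> even_subsets n. card (sym_diff P {..<k + 2}) = k \<and> card P = 2}"
  have "step_sum n (\<lambda>e. if e = k then 1 else 0) {..<k + 2} =
      (\<Sum>P\<in>even_subsets n. if card (sym_diff P {..<k + 2}) = k \<and> card P = 2 then 1 else 0)"
    unfolding step_sum_def by (intro sum.cong refl) simp
  also have "\<dots> = (\<Sum>P\<in>?X. 1)"
    by (rule sum.inter_filter[symmetric]) simp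
  finally have eq: "step_sum n (\<lambda>e. if e = k then 1 else 0) {..<k + 2} = of_nat (card ?X)"
    by (simp only: sum_constant mult_1_right)
  have "sym_diff {..<2} {..<k + 2} = {2..<k + 2}"
    by auto
  then have "card (sym_diff {..<2} {..<k + 2}) = k"
    by (simp only: card_atLeastLessThan add_diff_cancel_right')
  moreover have "{..<2} \<in> even_subsets n"
    using assms by (intro even_subsetsI) auto
  ultimately have "{..<2} \<in> ?X"
    by (intro CollectI conjI card_lessThan)
  moreover have "finite ?X"
    by simp
  ultimately have "card ?X > 0"
    by (subst card_gt_0_iff) blast
  then show ?thesis
    unfolding eq by (simp only: of_nat_eq_0_iff neq0_conv)
qed

section \<open>Matrices that depend on the distance, and the adjacency algebra\<close>

text \<open>The map \<open>s\<close> replaces the list of words: matrix index \<open>i\<close>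
  stands for the vertex \<open>s i\<close>, so the algebra can be treated with sets only.\<close>

locale even_subset_enumeration =
  fixes n N :: nat and s :: "nat \<Rightarrow> nat set"
  assumes bij_s: "bij_betw s {..<N} (even_subsets n)"
begin

definition dist_mat :: "(nat \<Rightarrow> complex) \<Rightarrow> complex mat" where
  "dist_mat f = mat N N (\<lambda>(i, j). f (card (sym_diff (s i) (s j))))"

abbreviation adj :: "complex mat" where
  "adj \<equiv> dist_mat (\<lambda>e. if e = 2 then 1 else 0)"

lemma dist_mat_carrier [simp]: "dist_mat f \<in> carrier_mat N N"
  and dim_dist_mat [simp]: "dim_row (dist_mat f) = N" "dim_col (dist_mat f) = N"
  by (simp_all add: dist_mat_def)

lemma index_dist_mat [simp]:
  "i < N \<Longrightarrow> j < N \<Longrightarrow> dist_mat f $$ (i, j) = f (card (sym_diff (s i) (s j)))"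
  by (simp add: dist_mat_def)

lemma s_in: "i < N \<Longrightarrow> s i \<in> even_subsets n"
  using bij_s by (auto simp: bij_betw_def)

lemma s_eq_iff: "i < N \<Longrightarrow> j < N \<Longrightarrow> s i = s j \<longleftrightarrow> i = j"
  using bij_s by (auto simp: bij_betw_def inj_on_def)

lemma obtain_index:
  assumes "S \<in> even_subsets n"
  obtains i where "i < N" "S = s i"
  using assms bij_s by (auto simp: bij_betw_def)

lemma sum_index: "(\<Sum>c<N. g (s c)) = (\<Sum>C\<in>even_subsets n. g C)"
  using bij_s by (rule sum.reindex_bij_betw)

lemma card_even_subsets: "card (even_subsets n) = N"
  using bij_betw_same_card[OF bij_s] by simp

text \<open>Only even arguments up to \<open>n\<close> occur as distances, since the symmetric
  difference of two vertices is again an even subset.\<close>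

lemma dist_mat_cong:
  assumes "\<And>e. even e \<Longrightarrow> e \<le> n \<Longrightarrow> f e = g e"
  shows "dist_mat f = dist_mat g"
  using assms even_subsetsD(2,4)[OF sym_diff_even_subsets[OF s_in s_in]]
  by (intro eq_matI) simp_all

lemma dist_mat_add: "dist_mat f + dist_mat g = dist_mat (\<lambda>e. f e + g e)"
  and dist_mat_smult: "c \<cdot>\<^sub>m dist_mat f = dist_mat (\<lambda>e. c * f e)"
  by (rule eq_matI; simp)+

lemma dist_mat_one: "1\<^sub>m N = dist_mat (\<lambda>e. if e = 0 then 1 else 0)"
    (is "_ = ?R")
proof (rule eq_matI)
  fix i j assume "i < dim_row ?R" "j < dim_col ?R"
  then have ij: "i < N" "j < N"
    by simp_all
  have "finite (sym_diff (s i) (s j))"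
    using ij by (intro even_subsetsD(3)[of _ n] sym_diff_even_subsets s_in)
  then have "card (sym_diff (s i) (s j)) = 0 \<longleftrightarrow> s i = s j"
    by auto
  then show "1\<^sub>m N $$ (i, j) = ?R $$ (i, j)"
    using ij s_eq_iff by simp
qed simp_all

text \<open>Translating the intermediate vertex by \<open>s j\<close> turns an entry into a
  \<open>step_sum\<close>, which depends only on the size of the difference; \<open>{..<e}\<close>
  serves as the representative of size \<open>e\<close>.\<close>

lemma dist_mat_mult_adj: "dist_mat f * adj = dist_mat (\<lambda>e. step_sum n f {..<e})"
    (is "_ = ?R")
proof (rule eq_matI)
  fix i j assume "i < dim_row ?R" "j < dim_col ?R"
  then have ij: "i < N" "j < N"
    by simp_all
  let ?D = "sym_diff (s i) (s j)"
  have D: "?D \<in> even_subsets n"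
    using ij by (intro sym_diff_even_subsets s_in)
  have "(dist_mat f * adj) $$ (i, j) =
      (\<Sum>c<N. f (card (sym_diff (s i) (s c))) * (if card (sym_diff (s c) (s j)) = 2 then 1 else 0))"
    using ij by (simp add: scalar_prod_def lessThan_atLeast0)
  also have "\<dots> = (\<Sum>C\<in>even_subsets n.
      f (card (sym_diff (s i) C)) * (if card (sym_diff C (s j)) = 2 then 1 else 0))"
    by (rule sum_index)
  also have "\<dots> = (\<Sum>C\<in>even_subsets n. f (card (sym_diff (s i) (sym_diff C (s j)))) *
      (if card (sym_diff (sym_diff C (s j)) (s j)) = 2 then 1 else 0))"
    using s_in[OF ij(2)] by (rule sum_even_subsets_translate)
  also have "\<dots> = step_sum n f ?D"
  proof -
    have "sym_diff (s i) (sym_diff C (s j)) = sym_diff C ?D" for C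
      by auto
    then show ?thesis
      unfolding step_sum_def sym_diff_cancel by simp
  qed
  also have "\<dots> = step_sum n f {..<card ?D}"
    using even_subsetsD[OF D] by (intro step_sum_cong_card) auto
  finally show "(dist_mat f * adj) $$ (i, j) = ?R $$ (i, j)"
    using ij by simp
qed simp_all

sublocale mat: vectorspace class_ring "module_mat TYPE(complex) N N"
  by (rule matrix_vs)

abbreviation adj_span :: "complex mat set" where
  "adj_span \<equiv> mat.span (range (\<lambda>k. adj ^\<^sub>m k))"

lemma pow_adj_carrier: "adj ^\<^sub>m k \<in> carrier_mat N N"
  by simp

lemma submodule_adj_span: "submodule class_ring adj_span (module_mat TYPE(complex) N N)"
  by (rule mat.span_is_submodule) (auto simp: module_mat_simps pow_adj_carrier)

lemma adj_span_add: "X \<in> adj_span \<Longrightarrow> Y \<in> adj_span \<Longrightarrow> X + Y \<in> adj_span"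
  and adj_span_smult: "X \<in> adj_span \<Longrightarrow> c \<cdot>\<^sub>m X \<in> adj_span"
  and adj_span_zero: "0\<^sub>m N N \<in> adj_span"
  using submodule_adj_span by (auto simp: submodule_def module_mat_simps)

lemma pow_adj_in_span: "adj ^\<^sub>m k \<in> adj_span"
  by (rule subsetD[OF mat.in_own_span]) (auto simp: module_mat_simps pow_adj_carrier)

text \<open>The matrices whose product with \<open>adj\<close> lies in the span form a submodule
  containing every power of \<open>adj\<close>.\<close>

lemma adj_span_mult_adj:
  assumes "X \<in> adj_span"
  shows "X * adj \<in> adj_span"
proof -
  let ?T = "{X \<in> carrier_mat N N. X * adj \<in> adj_span}"
  have "adj_span \<subseteq> ?T"
  proof (rule mat.span_is_subset)
    have "adj ^\<^sub>m k * adj \<in> adj_span" for k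
      using pow_adj_in_span[of "Suc k"] by simp
    then show "range (\<lambda>k. adj ^\<^sub>m k) \<subseteq> ?T"
      by (intro image_subsetI CollectI conjI pow_adj_carrier)
    have add: "(X + Y) * adj \<in> adj_span"
      if "X \<in> carrier_mat N N \<and> X * adj \<in> adj_span" "Y \<in> carrier_mat N N \<and> Y * adj \<in> adj_span" for X Y
      using that by (subst add_mult_distrib_mat[of _ N N _ _ N]) (auto intro: adj_span_add)
    have smult: "(c \<cdot>\<^sub>m X) * adj \<in> adj_span"
      if "X \<in> carrier_mat N N \<and> X * adj \<in> adj_span" for c X
      using that by (subst mult_smult_assoc_mat[of _ N N _ N]) (auto intro: adj_span_smult)
    show "submodule class_ring ?T (module_mat TYPE(complex) N N)"
      by (rule submodule.intro)
        (simp_all add: module_mat_simps mat.module_axioms adj_span_zero add smult subsetI)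
  qed
  then show ?thesis
    using assms by blast
qed

text \<open>The right-hand side is a submodule that contains the identity and is closed under right
  multiplication by \<open>adj\<close>.\<close>

lemma adj_span_subset: "adj_span \<subseteq> range dist_mat"
proof (rule mat.span_is_subset)
  have "adj ^\<^sub>m k \<in> range dist_mat" for k
    by (induction k) (auto simp: dist_mat_one dist_mat_mult_adj)
  then show "range (\<lambda>k. adj ^\<^sub>m k) \<subseteq> range dist_mat"
    by auto
  have "0\<^sub>m N N = dist_mat (\<lambda>_. 0)"
    by (rule eq_matI) auto
  then show "submodule class_ring (range dist_mat) (module_mat TYPE(complex) N N)"
    by (intro submodule.intro)
      (auto simp: module_mat_simps mat.module_axioms dist_mat_add dist_mat_smult)
qed

text \<open>Triangular elimination: the value of \<open>f\<close> at the largest distance is removed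
  by a multiple of a matrix already known to be in the span, and the induction hypothesis handles
  the rest.\<close>

lemma dist_mat_in_adj_span:
  assumes "2 \<le> n"
  shows "(\<And>e. even e \<Longrightarrow> 2 * j < e \<Longrightarrow> f e = 0) \<Longrightarrow> dist_mat f \<in> adj_span"
proof (induction j arbitrary: f)
  case 0
  have "dist_mat f = dist_mat (\<lambda>e. f 0 * (if e = 0 then 1 else 0))"
    using 0 by (intro dist_mat_cong) auto
  also have "\<dots> = f 0 \<cdot>\<^sub>m (adj ^\<^sub>m 0)"
    by (simp add: dist_mat_smult dist_mat_one)
  finally show ?case
    using adj_span_smult[OF pow_adj_in_span[of 0]] by simp
next
  case (Suc j)
  let ?I = "\<lambda>e. if e = 2 * j then 1 else 0 :: complex"
  define g where "g e = step_sum n ?I {..<e}" for e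
  have "dist_mat g \<in> adj_span"
    \<comment> \<open>The induction hypothesis puts the distance-\<open>2 * j\<close> matrix into
      the span, and \<open>dist_mat g\<close> is its product with \<open>adj\<close>.\<close>
    unfolding g_def dist_mat_mult_adj[symmetric] by (intro adj_span_mult_adj Suc.IH) simp
  have g0: "g (2 * j + 2) \<noteq> 0"
    unfolding g_def using assms by (rule step_sum_indicator_neq_0)
  define c where "c = f (2 * j + 2) / g (2 * j + 2)"
  have "dist_mat (\<lambda>e. f e - c * g e) \<in> adj_span"
  proof (rule Suc.IH)
    fix e :: nat assume e: "even e" "2 * j < e"
    show "f e - c * g e = 0"
    proof (cases "e = 2 * j + 2")
      case True
      then show ?thesis using g0 by (simp add: c_def)
    next
      case False
      then have "2 * j + 2 < e"
        using e by presburger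
      then show ?thesis
        using Suc.prems[of e] e by (simp add: g_def step_sum_indicator_eq_0)
    qed
  qed
  then have "dist_mat (\<lambda>e. f e - c * g e) + c \<cdot>\<^sub>m dist_mat g \<in> adj_span"
    using \<open>dist_mat g \<in> adj_span\<close> adj_span_add adj_span_smult by blast
  then show ?case
    by (simp add: dist_mat_smult dist_mat_add)
qed

lemma adj_span_eq:
  assumes "2 \<le> n"
  shows "adj_span = range dist_mat"
proof
  show "range dist_mat \<subseteq> adj_span"
  proof safe
    fix f
    \<comment> \<open>Cutting \<open>f\<close> off above \<open>n\<close> does not change the
      matrix, and makes the vanishing condition hold with \<open>j = n\<close>.\<close>
    have "dist_mat (\<lambda>e. if e \<le> n then f e else 0) \<in> adj_span"
      by (rule dist_mat_in_adj_span[OF assms, of n]) simp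
    moreover have "dist_mat (\<lambda>e. if e \<le> n then f e else 0) = dist_mat f"
      by (intro dist_mat_cong) auto
    ultimately show "dist_mat f \<in> adj_span"
      by (simp only:)
  qed
qed (rule adj_span_subset)

section \<open>The Hadamard condition in terms of even subsets\<close>

lemma complex_hadamard_dist_mat_iff:
  "complex_hadamard (dist_mat f) \<longleftrightarrow>
     (\<forall>S\<in>even_subsets n. cmod (f (card S)) = 1) \<and>
     (\<forall>U\<in>even_subsets n. \<forall>V\<in>even_subsets n. U \<noteq> V \<longrightarrow>
        (\<Sum>C\<in>even_subsets n. f (card (sym_diff U C)) / f (card (sym_diff V C))) = 0)"
    (is "?L \<longleftrightarrow> ?M \<and> ?O")
proof -
  have rows: "(\<Sum>c<N. dist_mat f $$ (a, c) / dist_mat f $$ (b, c)) =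
      (\<Sum>C\<in>even_subsets n. f (card (sym_diff (s a) C)) / f (card (sym_diff (s b) C)))"
    if "a < N" "b < N" for a b
  proof -
    have "(\<Sum>c<N. dist_mat f $$ (a, c) / dist_mat f $$ (b, c)) =
        (\<Sum>c<N. f (card (sym_diff (s a) (s c))) / f (card (sym_diff (s b) (s c))))"
      using that by simp
    also have "\<dots> = (\<Sum>C\<in>even_subsets n.
        f (card (sym_diff (s a) C)) / f (card (sym_diff (s b) C)))"
      by (rule sum_index)
    finally show ?thesis .
  qed
  show ?thesis
  proof
    assume L: ?L
    have ?M
    proof
      fix S assume "S \<in> even_subsets n"
      then obtain i where i: "i < N" "S = s i"
        by (rule obtain_index)
      \<comment> \<open>The column of the empty set shows that every size \<open>card S\<close> is a
        distance.\<close>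
      obtain j where j: "j < N" "{} = s j"
        by (rule obtain_index[of "{}"]) (auto intro: even_subsetsI)
      have "cmod (dist_mat f $$ (i, j)) = 1"
        using L i(1) j(1) unfolding complex_hadamard_def dim_dist_mat by blast
      then have "cmod (f (card (sym_diff (s i) (s j)))) = 1"
        using i(1) j(1) by (simp only: index_dist_mat)
      then show "cmod (f (card S)) = 1"
        unfolding i(2) j(2)[symmetric] by simp
    qed
    moreover have ?O
    proof (intro ballI impI)
      fix U V assume UV: "U \<in> even_subsets n" "V \<in> even_subsets n" "U \<noteq> V"
      obtain i where i: "i < N" "U = s i"
        using UV(1) by (rule obtain_index)
      obtain j where j: "j < N" "V = s j"
        using UV(2) by (rule obtain_index)
      have "i \<noteq> j"
        using UV(3) i(2) j(2) by blast
      moreover have "(\<Sum>c<N. dist_mat f $$ (i, c) / dist_mat f $$ (j, c)) =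
          (if i = j then of_nat N else 0)"
        using L i(1) j(1) unfolding complex_hadamard_def type_II_def dim_dist_mat by blast
      ultimately show "(\<Sum>C\<in>even_subsets n. f (card (sym_diff U C)) / f (card (sym_diff V C))) = 0"
        unfolding i(2) j(2) rows[OF i(1) j(1)] by (simp only: if_False)
    qed
    ultimately show "?M \<and> ?O" ..
  next
    assume MO: "?M \<and> ?O"
    have cmod1: "cmod (f (card (sym_diff U V))) = 1"
      if "U \<in> even_subsets n" "V \<in> even_subsets n" for U V
      by (rule bspec[OF conjunct1[OF MO] sym_diff_even_subsets[OF that]])
    have nz: "f (card (sym_diff U V)) \<noteq> 0"
      if "U \<in> even_subsets n" "V \<in> even_subsets n" for U V
    proof
      assume "f (card (sym_diff U V)) = 0"
      then show False
        using cmod1[OF that] by (simp only: norm_zero zero_neq_one)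
    qed
    have orth: "(\<Sum>c<N. dist_mat f $$ (a, c) / dist_mat f $$ (b, c)) =
        (if a = b then of_nat N else 0)"
      if ab: "a < N" "b < N" for a b
    proof (cases "a = b")
      case True
      have "(\<Sum>C\<in>even_subsets n. f (card (sym_diff (s b) C)) / f (card (sym_diff (s b) C))) =
          (\<Sum>C\<in>even_subsets n. 1)"
        using nz[OF s_in[OF ab(2)]] by (intro sum.cong divide_self refl)
      then show ?thesis
        unfolding rows[OF ab] unfolding True by (simp add: card_even_subsets)
    next
      case False
      then have "s a \<noteq> s b"
        using s_eq_iff[OF ab] by blast
      then show ?thesis
        unfolding rows[OF ab] using False conjunct2[OF MO] s_in[OF ab(1)] s_in[OF ab(2)]
        by (simp only: if_False) blast
    qed
    have "square_mat (dist_mat f)"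
      by simp
    moreover have "dist_mat f $$ (a, b) \<noteq> 0" "cmod (dist_mat f $$ (a, b)) = 1"
      if "a < N" "b < N" for a b
      unfolding index_dist_mat[OF that]
      by (rule nz[OF s_in[OF that(1)] s_in[OF that(2)]], rule cmod1[OF s_in[OF that(1)] s_in[OF that(2)]])
    ultimately show ?L
      unfolding complex_hadamard_def type_II_def dim_dist_mat using orth by blast
  qed
qed

end

section \<open>Odd n: the alternating function works\<close>

text \<open>Toggling two elements changes the size by 2 if both or neither lie in \<open>S\<close>,
  and leaves it unchanged otherwise.\<close>

lemma sign_sym_diff_pair:
  fixes S :: "nat set"
  assumes "finite S" "even (card S)" "i \<noteq> j"
  shows "(- 1 :: complex) ^ (card (sym_diff S {i, j}) div 2) =
    (if i \<in> S \<longleftrightarrow> j \<in> S then - 1 else 1) * (- 1) ^ (card S div 2)"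
proof -
  have "S \<inter> {i, j} = (if i \<in> S then {i} else {}) \<union> (if j \<in> S then {j} else {})"
    by auto
  then have int: "card (S \<inter> {i, j}) = (if i \<in> S then 1 else 0) + (if j \<in> S then 1 else 0)"
    using assms by auto
  have card: "card (sym_diff S {i, j}) + 2 * card (S \<inter> {i, j}) = card S + 2"
    using card_sym_diff[of S "{i, j}"] assms by simp
  obtain k where k: "card S = 2 * k"
    using assms by blast
  consider "i \<in> S" "j \<in> S" | "i \<notin> S" "j \<notin> S" | "i \<in> S \<longleftrightarrow> j \<notin> S"
    by blast
  then show ?thesis
  proof cases
    case 1
    then have "card (sym_diff S {i, j}) + 2 = card S"
      using card int by simp
    then have "card S div 2 = Suc (card (sym_diff S {i, j}) div 2)"
      by presburger
    then show ?thesis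
      using 1 by simp
  next
    case 2
    then have "card (sym_diff S {i, j}) = card S + 2"
      using card int by simp
    then show ?thesis
      using 2 by simp
  next
    case 3
    then have "card (sym_diff S {i, j}) = card S"
      using card int by (auto split: if_splits)
    then show ?thesis
      using 3 by auto
  qed
qed

lemma alternating_rows_orthogonal:
  assumes "odd n" and U: "U \<in> even_subsets n" and V: "V \<in> even_subsets n" and "U \<noteq> V"
  shows "(\<Sum>C\<in>even_subsets n. (- 1 :: complex) ^ (card (sym_diff U C) div 2) /
    (- 1) ^ (card (sym_diff V C) div 2)) = 0"
    (is "(\<Sum>C\<in>_. ?t C) = 0")
proof -
  have D: "sym_diff U V \<in> even_subsets n"
    using U V by (rule sym_diff_even_subsets)
  obtain i where i: "i \<in> sym_diff U V"
    using \<open>U \<noteq> V\<close> by blast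
  have "sym_diff U V \<noteq> {..<n}"
  proof
    assume "sym_diff U V = {..<n}"
    then show False
      using even_subsetsD(2)[OF D] \<open>odd n\<close> by (simp only: card_lessThan)
  qed
  then obtain j where j: "j < n" "j \<notin> sym_diff U V"
    using even_subsetsD(1)[OF D] by blast
  have "i \<noteq> j" "i < n"
    using i j(2) even_subsetsD(1)[OF D] by blast+
  then have P: "{i, j} \<in> even_subsets n"
    using j by (auto intro: even_subsetsI)
  have "?t (sym_diff C {i, j}) = - ?t C" if C: "C \<in> even_subsets n" for C
  proof -
    note UC = sym_diff_even_subsets[OF U C] and VC = sym_diff_even_subsets[OF V C]
    have sgn: "(- 1 :: complex) ^ (card (sym_diff S (sym_diff C {i, j})) div 2) =
        (if i \<in> sym_diff S C \<longleftrightarrow> j \<in> sym_diff S C then - 1 else 1) *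
        (- 1) ^ (card (sym_diff S C) div 2)"
      if "sym_diff S C \<in> even_subsets n" for S
      using sign_sym_diff_pair[OF even_subsetsD(3,2)[OF that] \<open>i \<noteq> j\<close>]
      by (simp only: sym_diff_assoc)
    \<comment> \<open>\<open>U\<close> and \<open>V\<close> disagree at \<open>i\<close> and agree
      at \<open>j\<close>, so exactly one of numerator and denominator changes sign.\<close>
    have flip: "(i \<in> sym_diff U C \<longleftrightarrow> j \<in> sym_diff U C) \<longleftrightarrow>
        \<not> (i \<in> sym_diff V C \<longleftrightarrow> j \<in> sym_diff V C)"
      using i j by blast
    have "(if p then - 1 else 1) * x / ((if q then - 1 else 1) * y) = - (x / y)"
      if "p \<longleftrightarrow> \<not> q" for p q and x y :: complex
      using that by (cases q) simp_all
    from this[OF flip] show ?thesis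
      unfolding sgn[OF UC] sgn[OF VC] .
  qed
  then have "(\<Sum>C\<in>even_subsets n. ?t (sym_diff C {i, j})) = (\<Sum>C\<in>even_subsets n. - ?t C)"
    by (intro sum.cong refl)
  then have "(\<Sum>C\<in>even_subsets n. ?t C) = - (\<Sum>C\<in>even_subsets n. ?t C)"
    unfolding sum_even_subsets_translate[OF P, of ?t, symmetric] sum_negf .
  then show ?thesis
    by (simp add: equal_neg_zero)
qed

section \<open>Necessity of odd n\<close>

lemma unimodular_Re_eq_minus_1:
  assumes "cmod z = 1" "Re z = - 1"
  shows "z = - 1"
  using assms cmod_power2[of z] by (simp add: complex_eq_iff)

lemma orthogonal_rows_imp_alternating:
  assumes n: "3 \<le> n"
    and unimod: "\<And>S. S \<in> even_subsets n \<Longrightarrow> cmod (f (card S)) = 1"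
    and orth: "\<And>U V. U \<in> even_subsets n \<Longrightarrow> V \<in> even_subsets n \<Longrightarrow> U \<noteq> V \<Longrightarrow>
        (\<Sum>C\<in>even_subsets n. f (card (sym_diff U C)) / f (card (sym_diff V C))) = 0"
    and k: "even k" "k + 2 \<le> n"
  shows "f (k + 2) = - f k"
proof -
  define t where "t C = f (card C) / f (card (sym_diff {0, 1} C))" for C :: "nat set"
  define A where "A = {C \<in> even_subsets n. 0 \<in> C \<longleftrightarrow> 1 \<in> C}"
  define B where "B = {C \<in> even_subsets n. \<not> (0 \<in> C \<longleftrightarrow> 1 \<in> C)}"
  have V: "{0, 1} \<in> even_subsets n" and P: "{0, 2} \<in> even_subsets n"
    using n by (auto intro: even_subsetsI)
  have AB: "even_subsets n = A \<union> B" "A \<inter> B = {}" "finite A" "finite B"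
    by (auto simp: A_def B_def)
  \<comment> \<open>Toggling 0 and 2 changes membership of 0 but not of 1; the element 2 is
    available because \<open>3 \<le> n\<close>.\<close>
  have "bij_betw (\<lambda>C. sym_diff C {0, 2}) A B"
    by (rule bij_betwI[of _ _ _ "\<lambda>C. sym_diff C {0, 2}"])
      (auto simp: A_def B_def sym_diff_even_subsets[OF _ P] simp del: Un_insert_left Un_insert_right)
  then have cardAB: "card A = card B"
    by (rule bij_betw_same_card)
  have unimod_t: "cmod (t C) = 1" if "C \<in> even_subsets n" for C
    using unimod[OF that] unimod[OF sym_diff_even_subsets[OF V that]] by (simp only: t_def norm_divide div_by_1)
  \<comment> \<open>Toggling 0 and 1 removes one element and adds one, so the size stays the
    same.\<close>
  have tB: "t C = 1" if "C \<in> B" for C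
  proof -
    have C: "C \<in> even_subsets n" "\<not> (0 \<in> C \<longleftrightarrow> 1 \<in> C)"
      using that by (auto simp: B_def)
    then have "{0, 1} \<inter> C = {0} \<or> {0, 1} \<inter> C = {1}"
      by auto
    then have "card ({0, 1} \<inter> C) = 1"
      by (elim disjE) simp_all
    moreover have "card {0, 1 :: nat} = 2" "finite {0, 1 :: nat}"
      by simp_all
    ultimately have "card (sym_diff {0, 1} C) = card C"
      using card_sym_diff[of "{0, 1}" C] even_subsetsD(3)[OF C(1)] by linarith
    moreover have "f (card C) \<noteq> 0"
      using unimod[OF C(1)] by fastforce
    ultimately show ?thesis
      by (simp add: t_def)
  qed
  have "{} \<in> even_subsets n"
    by (auto intro: even_subsetsI)
  then have "(\<Sum>C\<in>even_subsets n. t C) = 0"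
    using orth[of "{}" "{0, 1}"] V by (simp add: t_def)
  then have "(\<Sum>C\<in>A. t C) + of_nat (card A) = 0"
    using AB tB cardAB by (simp add: sum.union_disjoint)
  then have "Re (\<Sum>C\<in>A. t C) + real (card A) = 0"
    by (metis Re_complex_of_real of_real_of_nat_eq plus_complex.sel(1) zero_complex.sel(1))
  \<comment> \<open>The summands are nonnegative because the ratios are unimodular, so each of them
    vanishes.\<close>
  then have sum0: "(\<Sum>C\<in>A. Re (t C) + 1) = 0"
    by (simp add: sum.distrib)
  have nonneg: "0 \<le> Re (t C) + 1" if "C \<in> A" for C
    using abs_Re_le_cmod[of "t C"] unimod_t[of C] that by (simp add: A_def)
  have Re_t: "Re (t C) = - 1" if "C \<in> A" for C
    using sum_nonneg_0[OF AB(3) nonneg sum0 that] by simp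
  \<comment> \<open>This set has \<open>k\<close> elements and avoids 0 and 1, so toggling them
    yields the \<open>k + 2\<close> elements of \<open>{..<k + 2}\<close>.\<close>
  have C: "{2..<k + 2} \<in> A"
    using k by (auto simp: A_def intro: even_subsetsI)
  then have "t {2..<k + 2} = - 1"
    using unimod_t[of "{2..<k + 2}"] by (intro unimodular_Re_eq_minus_1 Re_t) (auto simp: A_def)
  moreover have "sym_diff {0, 1} {2..<k + 2} = {..<k + 2}"
    by auto
  then have "t {2..<k + 2} = f k / f (k + 2)"
    by (simp add: t_def)
  moreover have "{..<k + 2} \<in> even_subsets n"
    using k by (auto intro: even_subsetsI)
  then have "f (k + 2) \<noteq> 0"
    using unimod[of "{..<k + 2}"] by auto
  ultimately have "f k = - f (k + 2)"
    by (metis mult_minus1 nonzero_eq_divide_eq)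
  then show ?thesis
    by simp
qed

lemma orthogonal_rows_imp_odd:
  assumes n: "3 \<le> n"
    and unimod: "\<And>S. S \<in> even_subsets n \<Longrightarrow> cmod (f (card S)) = 1"
    and orth: "\<And>U V. U \<in> even_subsets n \<Longrightarrow> V \<in> even_subsets n \<Longrightarrow> U \<noteq> V \<Longrightarrow>
        (\<Sum>C\<in>even_subsets n. f (card (sym_diff U C)) / f (card (sym_diff V C))) = 0"
  shows "odd n"
proof
  assume "even n"
  then obtain m where m: "n = 2 * m" ..
  have alt: "f (2 * j) = (- 1) ^ j * f 0" if "2 * j \<le> n" for j
    using that
  proof (induction j)
    case (Suc j)
    then show ?case
      using orthogonal_rows_imp_alternating[OF n unimod orth, where k = "2 * j"] by simp
  qed simp
  have E: "{} \<in> even_subsets n" "{..<n} \<in> even_subsets n"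
    using \<open>even n\<close> by (auto intro: even_subsetsI)
  have "{} \<noteq> {..<n}"
    using n by (metis card.empty card_lessThan not_numeral_le_zero)
  have f0: "f 0 \<noteq> 0"
    using unimod[OF E(1)] by auto
  \<comment> \<open>For \<open>card C = 2 * j\<close> and a complement of size \<open>2 * l\<close>
    the ratio is \<open>(- 1) ^ j / (- 1) ^ l = (- 1) ^ (j + l)\<close>, and
    \<open>j + l = m\<close> is the same for all \<open>C\<close>. A sum of equal nonzero terms
    cannot be 0.\<close>
  have "f (card (sym_diff {} C)) / f (card (sym_diff {..<n} C)) = (- 1) ^ m"
    if C: "C \<in> even_subsets n" for C
  proof -
    obtain j where j: "card C = 2 * j"
      using even_subsetsD(2)[OF C] by blast
    have "j \<le> m"
      using even_subsetsD(4)[OF C] j m by linarith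
    then obtain l where l: "m = j + l"
      using le_Suc_ex by blast
    have "sym_diff {..<n} C = {..<n} - C"
      using even_subsetsD(1)[OF C] by auto
    then have "card (sym_diff {..<n} C) = 2 * l"
      using even_subsetsD(1,3)[OF C] j m l by (simp add: card_Diff_subset)
    then show ?thesis
      using f0 j alt[of j] alt[of l] m l
      by (simp add: power_add field_simps flip: power_mult_distrib)
  qed
  then have "of_nat (card (even_subsets n)) * (- 1 :: complex) ^ m = 0"
    using orth[OF E \<open>{} \<noteq> {..<n}\<close>] by simp
  then show False
    using E(1) by auto
qed

section \<open>From even words to even subsets\<close>

definition true_positions :: "bool list \<Rightarrow> nat set" where
  "true_positions w = {i. i < length w \<and> w ! i}"

lemma card_true_positions: "card (true_positions w) = count_list w True"
  unfolding true_positions_def count_list_eq_length_filter length_filter_conv_card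
  by (rule arg_cong[where f = card]) auto

lemma bij_betw_true_positions: "bij_betw true_positions (even_words n) (even_subsets n)"
proof (rule bij_betwI')
  fix v w assume "v \<in> even_words n" "w \<in> even_words n"
  then have "length v = n" "length w = n"
    by (simp_all add: even_words_def)
  then show "(true_positions v = true_positions w) = (v = w)"
    by (auto simp: true_positions_def set_eq_iff list_eq_iff_nth_eq)
next
  fix w assume "w \<in> even_words n"
  then have w: "length w = n" "even (count_list w True)"
    by (simp_all add: even_words_def)
  have "true_positions w \<subseteq> {..<n}"
    using w(1) by (auto simp: true_positions_def)
  then show "true_positions w \<in> even_subsets n"
    using w(2) by (intro even_subsetsI) (simp_all add: card_true_positions)
next
  fix S assume S: "S \<in> even_subsets n"
  \<comment> \<open>The characteristic word of \<open>S\<close>.\<close>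
  let ?w = "map (\<lambda>i. i \<in> S) [0..<n]"
  have w: "true_positions ?w = S"
    using even_subsetsD(1)[OF S] by (auto simp: true_positions_def)
  then have "even (count_list ?w True)"
    using even_subsetsD(2)[OF S] card_true_positions[of ?w] by (simp only:)
  then have "?w \<in> even_words n"
    unfolding even_words_def by simp
  then show "\<exists>w\<in>even_words n. S = true_positions w"
    using w by blast
qed

text \<open>Two Boolean words differ at a coordinate exactly when one of them is true there.
  Adjacency in the halved cube thus becomes a symmetric difference of size 2.\<close>

lemma hamming_dist_true_positions:
  assumes "length u = length v"
  shows "hamming_dist u v = card (sym_diff (true_positions u) (true_positions v))"
  unfolding hamming_dist_def true_positions_def using assms
  by (intro arg_cong[where f = card]) auto

theorem theorem5p1:
  fixes n :: nat and vs :: "bool list list"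
  assumes "n \<ge> 3"
    and "distinct vs" and "set vs = verts (halved_cube n)"
  shows "(\<exists>W \<in> adjacency_algebra (halved_cube n) vs. complex_hadamard W) \<longleftrightarrow> odd n"
proof -
  have set_vs: "set vs = even_words n"
    using assms(3) by (simp add: halved_cube_def)
  let ?s = "\<lambda>i. true_positions (vs ! i)"
  have "bij_betw ((!) vs) {..<length vs} (even_words n)"
    using bij_betw_nth[OF assms(2)] set_vs by simp
  then have "bij_betw ?s {..<length vs} (even_subsets n)"
    using bij_betw_trans[OF _ bij_betw_true_positions] by (simp add: comp_def)
  then interpret even_subset_enumeration n "length vs" ?s
    by unfold_locales
  have vs_in: "vs ! i \<in> even_words n" if "i < length vs" for i
    using that set_vs nth_mem by blast
  have adj: "adjacency_matrix (halved_cube n) vs = adj"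
  proof (rule eq_matI)
    fix i j assume "i < dim_row adj" "j < dim_col adj"
    then have ij: "i < length vs" "j < length vs"
      by simp_all
    then have "length (vs ! i) = length (vs ! j)"
      using vs_in by (simp add: even_words_def)
    then show "adjacency_matrix (halved_cube n) vs $$ (i, j) = adj $$ (i, j)"
      using ij vs_in
      by (simp add: adjacency_matrix_def halved_cube_def hamming_dist_true_positions)
  qed (simp_all add: adjacency_matrix_def)
  have algebra: "adjacency_algebra (halved_cube n) vs = range dist_mat"
    using adj_span_eq assms(1) by (simp add: adjacency_algebra_def adj)
  show ?thesis
  proof
    assume "\<exists>W \<in> adjacency_algebra (halved_cube n) vs. complex_hadamard W"
    then obtain f where "complex_hadamard (dist_mat f)"
      unfolding algebra by blast
    then show "odd n"
      using orthogonal_rows_imp_odd[of n f] assms(1) by (simp add: complex_hadamard_dist_mat_iff)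
  next
    assume "odd n"
    then have "complex_hadamard (dist_mat (\<lambda>e. (- 1) ^ (e div 2)))"
      using alternating_rows_orthogonal
      by (simp add: complex_hadamard_dist_mat_iff norm_power)
    then show "\<exists>W \<in> adjacency_algebra (halved_cube n) vs. complex_hadamard W"
      unfolding algebra by blast
  qed
qed

end
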